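(* Let $\Phi=(D,\varphi)$ be a $\mathbb{T}$-gain digraph on $n$ vertices. Let $\mathcal{E}_k(D)$ be the set of all elementary subdigraphs of $D$ covering exactly $k$ vertices. Then the characteristic polynomial of $A(\Phi)$ is $$\det(\lambda I-A(\Phi))=\sum_{k=0}^{n}a_k(\Phi)\,\lambda^{n-k},$$ where $a_0(\Phi)=1$ and $a_k(\Phi)=\sum_{\mathsf{E}\in\mathcal{E}_k(D)}(-1)^{c(\mathsf{E})}\varphi(\mathsf{E})$ for $k=1,\dots,n$.
   Context: A digraph $D=(V,\mathcal{A})$ has a finite vertex set $V=\{v_1,\dots,v_n\}$ and a set $\mathcal{A}$ of ordered pairs of distinct vertices, called arcs (no loops; at most one arc from $v_i$ to $v_j$ for each ordered pair; opposite arcs may both be present). A directed cycle is a closed directed walk whose vertices are distinct except that the first and last coincide (so its length is at least $2$; length $2$ is allowed). Let $\mathbb{T}=\{z\in\mathbb{C}:|z|=1\}$. A $\mathbb{T}$-gain digraph is a pair $\Phi=(D,\varphi)$ with $\varphi:\mathcal{A}\to\mathbb{T}$ an arbitrary function. Its gain adjacency matrix $A(\Phi)$ has entries $A(\Phi)_{ij}=\varphi(v_i,v_j)$ if $(v_i,v_j)\in\mathcal{A}$ and $0$ otherwise. An elementary subdigraph of $D$ is a subdigraph in which every vertex has in-degree and out-degree exactly $1$, equivalently a vertex-disjoint union of directed cycles of $D$. $c(\mathsf{E})$ is the number of directed cycles composing $\mathsf{E}$, and $\varphi(\mathsf{E})$ is the product of the gains $\varphi(C)$ of these cycles, where the gain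 of a directed cycle is the product of the gains of its arcs. *)

theory Defs
  imports
    "Jordan_Normal_Form.Char_Poly"
    "Graph_Theory.Digraph_Component"
begin

text \<open>
  Digraphs are Graph\_Theory's \<open>pair_digraph\<close>s: finite vertex set, arcs are ordered pairs of
  distinct vertices. A gain function is total on pairs; its values outside the arc set are never
  used.
\<close>

locale T_gain_digraph = pair_digraph D
  for D :: "'a pair_pre_digraph" +
  fixes \<phi> :: "'a \<times> 'a \<Rightarrow> complex"
  assumes norm_gain: "e \<in> parcs D \<Longrightarrow> cmod (\<phi> e) = 1"

text \<open>The list \<open>vs\<close> is the numbering of the vertices; indices start from 0.\<close>

definition gain_adjacency_matrix ::
    "'a pair_pre_digraph \<Rightarrow> ('a \<times> 'a \<Rightarrow> complex) \<Rightarrow> 'a list \<Rightarrow> complex mat" where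
  "gain_adjacency_matrix D \<phi> vs =
     mat (length vs) (length vs)
       (\<lambda>(i, j). if (vs ! i, vs ! j) \<in> parcs D then \<phi> (vs ! i, vs ! j) else 0)"

definition elementary_subdigraph :: "'a pair_pre_digraph \<Rightarrow> 'a pair_pre_digraph \<Rightarrow> bool" where
  "elementary_subdigraph E D \<longleftrightarrow>
     subgraph (with_proj E) (with_proj D) \<and>
     (\<forall>v \<in> pverts E. in_degree (with_proj E) v = 1 \<and> out_degree (with_proj E) v = 1)"

definition elementary_subdigraphs :: "'a pair_pre_digraph \<Rightarrow> nat \<Rightarrow> 'a pair_pre_digraph set" where
  "elementary_subdigraphs D k = {E. elementary_subdigraph E D \<and> card (pverts E) = k}"

text \<open>
  Graph\_Theory's \<open>cycle\<close> is a closed walk given by its arc list, hence comes with a starting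
  point. Passing to the set of arcs forgets it, so that each directed cycle is counted once.
\<close>

definition directed_cycles :: "'a pair_pre_digraph \<Rightarrow> ('a \<times> 'a) set set" where
  "directed_cycles E = {set p | p. pre_digraph.cycle (with_proj E) p}"

definition cycle_gain :: "('a \<times> 'a \<Rightarrow> complex) \<Rightarrow> ('a \<times> 'a) set \<Rightarrow> complex" where
  "cycle_gain \<phi> C = (\<Prod>e\<in>C. \<phi> e)"

definition num_cycles :: "'a pair_pre_digraph \<Rightarrow> nat" where
  "num_cycles E = card (directed_cycles E)"

definition elementary_gain :: "('a \<times> 'a \<Rightarrow> complex) \<Rightarrow> 'a pair_pre_digraph \<Rightarrow> complex" where
  "elementary_gain \<phi> E = (\<Prod>C\<in>directed_cycles E. cycle_gain \<phi> C)"

definition gain_coeff ::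
    "'a pair_pre_digraph \<Rightarrow> ('a \<times> 'a \<Rightarrow> complex) \<Rightarrow> nat \<Rightarrow> complex" where
  "gain_coeff D \<phi> k =
     (if k = 0 then 1
      else \<Sum>E\<in>elementary_subdigraphs D k. (- 1) ^ num_cycles E * elementary_gain \<phi> E)"

end

theory Submission
  imports Defs "HOL-Combinatorics.Cycles" "HOL-Combinatorics.Orbits"
begin

text \<open>
  In the Leibniz expansion of \<open>det (\<lambda>I - A)\<close>, a permutation \<open>p\<close> of the vertices contributes one
  factor \<open>\<lambda>\<close> per fixed point (there are no loops) and vanishes unless \<open>x \<mapsto> p x\<close> follows arcs on
  the support of \<open>p\<close>. Such permutations correspond to elementary subdigraphs, whose directed
  cycles are the nontrivial orbits of \<open>p\<close>. The \<open>k\<close> factors \<open>-1\<close> from the support, multiplied by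
  \<open>sign p = (-1)\<^sup>k\<^sup>-\<^sup>c\<close> with \<open>c\<close> the number of these orbits, give \<open>(-1)\<^sup>c\<close>.
\<close>

section \<open>Signs of permutations and numbers of orbits\<close>

text \<open>Each recursive step of \<open>cycle_of_list\<close> composes with one transposition of
  distinct points. Truncated subtraction makes the empty list fit: its cycle is \<open>id\<close>,
  of sign 1.\<close>

lemma sign_cycle_of_list:
  assumes "distinct cs"
  shows "sign (cycle_of_list cs) = (- 1) ^ (length cs - 1)"
  using assms
proof (induction cs rule: cycle_of_list.induct)
  case (1 i j cs)
  have "sign (cycle_of_list (i # j # cs)) = sign (Transposition.transpose i j) * sign (cycle_of_list (j # cs))"
    by (simp only: cycle_of_list.simps) (intro sign_compose permutation_swap_id permutation_of_cycle)
  with 1 show ?case by (auto simp: sign_swap_id comp_def)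
qed simp_all

text \<open>By \<open>cyclic_rotation\<close>, \<open>m\<close> applications of the cycle shift a
  position in \<open>cs\<close> by \<open>m\<close> modulo the length, so every position is reached
  from that of \<open>x\<close>.\<close>

lemma orbit_cycle_of_list:
  assumes "distinct cs" "x \<in> set cs"
  shows "orbit (cycle_of_list cs) x = set cs"
proof -
  obtain k where k: "k < length cs" "x = cs ! k"
    using assms(2) by (auto simp: in_set_conv_nth)
  have iter: "(cycle_of_list cs ^^ m) x = cs ! ((k + m) mod length cs)" for m
    using arg_cong[OF cyclic_rotation[OF assms(1), of m], of "\<lambda>l. l ! k"] k
    by (simp add: nth_rotate add.commute)
  have "orbit (cycle_of_list cs) x = {(cycle_of_list cs ^^ m) x | m. True}"
    by (rule orbit_altdef_permutation[OF permutation_of_cycle])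
  also have "\<dots> = set cs"
  proof (intro equalityI subsetI)
    fix y assume "y \<in> {(cycle_of_list cs ^^ m) x | m. True}"
    then obtain m where "y = cs ! ((k + m) mod length cs)" by (auto simp only: iter)
    then show "y \<in> set cs" using k(1) by (auto intro!: nth_mem mod_less_divisor)
  next
    fix y assume "y \<in> set cs"
    then obtain l where l: "l < length cs" "y = cs ! l" by (auto simp: in_set_conv_nth)
    \<comment> \<open>Starting at position \<open>k\<close>, this exponent leads to
      \<open>l + length cs\<close>, which is \<open>l\<close> modulo the length. The summand
      \<open>length cs\<close> keeps the subtraction of \<open>k\<close> from truncating.\<close>
    have "(cycle_of_list cs ^^ (l + length cs - k)) x = y"
      using k(1) l by (simp add: iter)
    then show "y \<in> {(cycle_of_list cs ^^ m) x | m. True}" by auto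
  qed
  finally show ?thesis .
qed

text \<open>A cycle on \<open>m > 0\<close> points has sign \<open>(- 1) ^ (m - 1)\<close>, which
  equals \<open>(- 1) ^ (m + 1)\<close>: one factor for each point and one for the orbit. A fixed
  point in \<open>S\<close> counts once as a point and once as an orbit, so it cancels.\<close>

lemma sign_conv_card_orbits:
  assumes "finite S" "p permutes S"
  shows "sign p = (- 1) ^ (card S + card (orbit p ` S))"
proof -
  \<comment> \<open>Finiteness and \<open>permutes\<close> are carried through the induction because
    the step uses both for the smaller permutation.\<close>
  have "finite S \<and> p permutes S \<and> sign p = (- 1) ^ (card S + card (orbit p ` S))"
    if "cycle_decomp S p" for S :: "'a set" and p
    using that
  proof induction
    case empty
    then show ?case by (auto simp: permutes_id)
  next
    case (comp I p cs)
    let ?c = "cycle_of_list cs" let ?q = "cycle_of_list cs \<circ> p"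
    have fin: "finite I" and perm: "p permutes I"
      and sgn: "sign p = (- 1) ^ (card I + card (orbit p ` I))" using comp.IH by auto
    have q_I: "?q x = p x" if "x \<in> I" for x
      using that comp.hyps perm by (auto intro!: id_outside_supp simp: permutes_in_image)
    have q_cs: "?q x = ?c x" if "x \<in> set cs" for x
    proof -
      have "x \<notin> I" using that comp.hyps(3) by blast
      then show ?thesis using perm by (simp add: permutes_not_in)
    qed
    have q: "?q permutes set cs \<union> I"
      by (intro permutes_compose permutes_subset[OF perm] permutes_subset[OF cycle_permutes]) auto
    \<comment> \<open>\<open>?q\<close> agrees with \<open>p\<close> on \<open>I\<close> and with
      \<open>?c\<close> on \<open>set cs\<close>. Both sets are invariant, so orbits inside them can
      be computed with the simpler map.\<close>
    have orb_I: "orbit ?q x = orbit p x" if "x \<in> I" for x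
      by (rule orbit_cong0[OF that, symmetric])
         (use q_I perm in \<open>auto simp: permutes_in_image\<close>)
    have "orbit ?q x = orbit ?c x" if "x \<in> set cs" for x
      by (rule orbit_cong0[OF that, symmetric])
         (use q_cs permutes_in_image[OF cycle_permutes[of cs]] in auto)
    then have orb_cs: "orbit ?q x = set cs" if "x \<in> set cs" for x
      using that orbit_cycle_of_list[OF comp.hyps(2)] by auto
    have "sign ?q = sign ?c * sign p"
      by (intro sign_compose permutation_of_cycle permutes_imp_permutation[OF fin perm])
    then have sgn_q: "sign ?q = (- 1) ^ (length cs - 1 + (card I + card (orbit p ` I)))"
      by (simp add: sgn sign_cycle_of_list[OF comp.hyps(2)] power_add)
    have card_un: "card (set cs \<union> I) = length cs + card I"
      using comp.hyps fin by (simp add: card_Un_disjoint distinct_card)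
    have "sign ?q = (- 1) ^ (card (set cs \<union> I) + card (orbit ?q ` (set cs \<union> I)))"
    \<comment> \<open>A cycle decomposition may contain empty cycles, which add no orbit; a nonempty
      one adds exactly the orbit \<open>set cs\<close>.\<close>
    proof (cases "cs = []")
      case True
      then show ?thesis using sgn by simp
    next
      case False
      then have "orbit ?q ` (set cs \<union> I) = insert (set cs) (orbit p ` I)"
        using orb_I orb_cs by (auto simp: image_Un image_iff)
      moreover have "set cs \<notin> orbit p ` I"
      proof
        assume "set cs \<in> orbit p ` I"
        then have "set cs \<subseteq> I" using permutes_orbit_subset[OF perm] by auto
        then show False using False comp.hyps(3) by (simp add: inf.absorb1)
      qed
      ultimately have "card (orbit ?q ` (set cs \<union> I)) = Suc (card (orbit p ` I))"
        using fin by simp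
      then show ?thesis using False sgn_q card_un by (cases cs) (simp_all add: ac_simps)
    qed
    then show ?case using fin q by blast
  qed
  then show ?thesis using cycle_decomposition[OF assms(2,1)] by blast
qed

section \<open>Digraphs of permutations and their directed cycles\<close>

text \<open>Fixed points are left out because they would be loops; they stand for the vertices that
  an elementary subdigraph does not cover.\<close>

definition permutation_digraph :: "('a \<Rightarrow> 'a) \<Rightarrow> 'a pair_pre_digraph" where
  "permutation_digraph p = \<lparr>pverts = {x. p x \<noteq> x}, parcs = {(x, p x) | x. p x \<noteq> x}\<rparr>"

text \<open>The graph of \<open>f\<close> offers a single successor at each vertex, so a walk has no
  freedom beyond its start and its length.\<close>

lemma pcas_function_graph:
  assumes "pcas u c v" "\<And>e. e \<in> set c \<Longrightarrow> snd e = f (fst e)"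
  shows "c = map (\<lambda>i. ((f ^^ i) u, (f ^^ Suc i) u)) [0..<length c] \<and> v = (f ^^ length c) u"
  using assms
proof (induction c arbitrary: u)
  case Nil
  then show ?case by simp
next
  case (Cons e c)
  then have e: "e = (u, f u)" by (metis list.set_intros(1) pcas.simps(2) prod.collapse)
  have "c = map (\<lambda>i. ((f ^^ i) (f u), (f ^^ Suc i) (f u))) [0..<length c] \<and> v = (f ^^ length c) (f u)"
    by (rule Cons.IH) (use Cons.prems e in auto)
  then show ?case
    unfolding e by (simp add: map_upt_Suc funpow_swap1 del: upt_Suc)
qed

lemma pcas_iterates:
  "pcas u (map (\<lambda>i. ((f ^^ i) u, (f ^^ Suc i) u)) [0..<n]) ((f ^^ n) u)"
proof (induction n arbitrary: u)
  case (Suc n)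
  show ?case using Suc[of "f u"] by (simp add: map_upt_Suc funpow_swap1 del: upt_Suc)
qed simp

text \<open>A closed walk in the graph of \<open>p\<close> runs through the whole orbit of its
  start. Conversely, following \<open>p\<close> from a moved point up to its least period gives a
  cycle on its orbit.\<close>

lemma directed_cycles_permutation_digraph:
  assumes "permutation p"
  shows "directed_cycles (permutation_digraph p) =
    (\<lambda>Z. (\<lambda>x. (x, p x)) ` Z) ` orbit p ` {x. p x \<noteq> x}"
proof (intro equalityI subsetI)
  let ?E = "permutation_digraph p"
  fix C assume "C \<in> directed_cycles ?E"
  then obtain c u where c: "C = set c" "c \<noteq> []" "pcas u c u"
    and u: "p u \<noteq> u" and arcs: "set c \<subseteq> {(x, p x) | x. p x \<noteq> x}"
    by (auto simp: directed_cycles_def pre_digraph.cycle_def pre_digraph.awalk_def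
        cas_with_proj_eq permutation_digraph_def)
  have graph: "snd e = p (fst e)" if "e \<in> set c" for e using that arcs by auto
  have c_eq: "c = map (\<lambda>i. ((p ^^ i) u, (p ^^ Suc i) u)) [0..<length c]"
    and period: "(p ^^ length c) u = u"
    using pcas_function_graph[OF c(3) graph] by auto
  have "C = (\<lambda>x. (x, p x)) ` {(p ^^ m) u | m. m < length c}"
    unfolding c(1) by (subst c_eq) (auto simp: image_iff)
  \<comment> \<open>The length of \<open>c\<close> is a positive period of \<open>u\<close>, so the
    iterates below it exhaust the orbit.\<close>
  also have "{(p ^^ m) u | m. m < length c} = orbit p u"
    using orbit_altdef_bounded[OF period] c(2) by simp
  finally show "C \<in> (\<lambda>Z. (\<lambda>x. (x, p x)) ` Z) ` orbit p ` {x. p x \<noteq> x}"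
    using u by auto
next
  let ?E = "permutation_digraph p"
  fix C assume "C \<in> (\<lambda>Z. (\<lambda>x. (x, p x)) ` Z) ` orbit p ` {x. p x \<noteq> x}"
  then obtain u where C: "C = (\<lambda>x. (x, p x)) ` orbit p u" and u: "p u \<noteq> u" by auto
  define n where "n = least_power p u"
  have n: "(p ^^ n) u = u" "0 < n"
    using least_power_of_permutation[OF assms] by (auto simp: n_def)
  define c where "c = map (\<lambda>i. ((p ^^ i) u, (p ^^ Suc i) u)) [0..<n]"
  have inj: "inj p" using assms by (simp add: bij_is_inj permutation_bijective)
  have cas: "pcas u c u" using pcas_iterates[of u p n] n by (simp add: c_def)
  have ne: "c \<noteq> []" using n by (simp add: c_def)
  have "p ((p ^^ i) u) \<noteq> (p ^^ i) u" for i
    using u inj_eq[OF inj_fn[OF inj, of i], of "p u" u] by (simp add: funpow_swap1)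
  then have arcs: "set c \<subseteq> parcs ?E" by (auto simp: c_def permutation_digraph_def)
  \<comment> \<open>\<open>cycle\<close> demands distinct vertices after the first. They are the
    images under the injective \<open>p\<close> of \<open>support p u\<close>, the iterates below
    the least period, which are distinct.\<close>
  have "tl (pawalk_verts u c) = map snd c"
    using pre_digraph.awalk_verts_conv'[of "with_proj ?E" u c u] cas ne
    by (simp add: cas_with_proj_eq awalk_verts_with_proj_eq)
  also have "map snd c = map p (support p u)"
    by (simp add: c_def n_def)
  also have "distinct \<dots>"
    using cycle_of_permutation[OF assms, of u] inj by (simp only: distinct_map) (auto intro: inj_on_subset)
  finally have "pre_digraph.cycle (with_proj ?E) c"
    using cas ne arcs u
    by (auto simp: pre_digraph.cycle_def pre_digraph.awalk_def cas_with_proj_eq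
        awalk_verts_with_proj_eq permutation_digraph_def intro!: exI[of _ u])
  moreover have "set c = C"
    unfolding C orbit_altdef_bounded[OF n] by (auto simp: c_def image_iff)
  ultimately show "C \<in> directed_cycles ?E" by (auto simp: directed_cycles_def)
qed

text \<open>The nontrivial orbits partition the support, so the product of cycle gains becomes a
  product over moved points. Negating each factor contributes \<open>(- 1) ^ card ?S\<close>, which
  cancels the same power inside \<open>sign p\<close> and leaves one sign for each orbit.\<close>

lemma elementary_term_permutation_digraph:
  fixes \<phi> :: "'a \<times> 'a \<Rightarrow> complex"
  assumes "permutation p"
  shows "(- 1) ^ num_cycles (permutation_digraph p) * elementary_gain \<phi> (permutation_digraph p) =
    of_int (sign p) * (\<Prod>x | p x \<noteq> x. - \<phi> (x, p x))"
proof -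
  let ?S = "{x. p x \<noteq> x}" let ?arcs = "\<lambda>Z. (\<lambda>x. (x, p x)) ` Z"
  have fin: "finite ?S" and perm: "p permutes ?S"
    using assms by (auto simp: permutation permutes_bij_inv_into bij_iff permutes_def)
  \<comment> \<open>Distinct orbits have distinct arc sets, so cycles can be counted and multiplied
    over orbits.\<close>
  have inj_arcs: "inj ?arcs"
    by (intro inj_onI) (auto simp: inj_image_eq_iff inj_def)
  have orbits: "orbit p x = orbit p y" if "z \<in> orbit p x" "z \<in> orbit p y" for x y z
    using cyclic_on_orbit'[OF assms] that by (metis orbit_cyclic_eq3)
  have union: "\<Union> (orbit p ` ?S) = ?S"
    using permutes_orbit_subset[OF perm] permutation_self_in_orbit[OF assms] by fastforce
  have dc: "directed_cycles (permutation_digraph p) = ?arcs ` orbit p ` ?S"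
    by (rule directed_cycles_permutation_digraph[OF assms])
  have "num_cycles (permutation_digraph p) = card (orbit p ` ?S)"
    unfolding num_cycles_def dc by (intro card_image inj_on_subset[OF inj_arcs]) simp
  moreover have "elementary_gain \<phi> (permutation_digraph p) = (\<Prod>x\<in>?S. \<phi> (x, p x))"
  proof -
    have "elementary_gain \<phi> (permutation_digraph p) =
        (\<Prod>Z\<in>orbit p ` ?S. cycle_gain \<phi> (?arcs Z))"
      unfolding elementary_gain_def dc
      by (subst prod.reindex[OF inj_on_subset[OF inj_arcs]]) auto
    also have "\<dots> = (\<Prod>Z\<in>orbit p ` ?S. \<Prod>x\<in>Z. \<phi> (x, p x))"
      unfolding cycle_gain_def by (intro prod.cong refl, subst prod.reindex) (auto intro: inj_onI)
    also have "\<dots> = (\<Prod>x\<in>\<Union> (orbit p ` ?S). \<phi> (x, p x))"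
    proof (subst prod.Union_disjoint)
      show "\<forall>Z\<in>orbit p ` ?S. finite Z"
        using permutation_self_in_orbit[OF assms] by (auto intro: finite_orbit)
      show "\<forall>Y\<in>orbit p ` ?S. \<forall>Z\<in>orbit p ` ?S. Y \<noteq> Z \<longrightarrow> Y \<inter> Z = {}"
        using orbits by blast
    qed simp
    finally show ?thesis by (simp add: union)
  qed
  moreover have "(\<Prod>x\<in>?S. - \<phi> (x, p x)) = (- 1) ^ card ?S * (\<Prod>x\<in>?S. \<phi> (x, p x))"
    using prod.distrib[of "\<lambda>_. - 1" "\<lambda>x. \<phi> (x, p x)" ?S] by simp
  moreover have "sign p = (- 1) ^ (card ?S + card (orbit p ` ?S))"
    by (rule sign_conv_card_orbits[OF fin perm])
  ultimately show ?thesis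
    by (simp add: power_add mult.assoc[symmetric] power_mult_distrib[symmetric])
qed

section \<open>Correspondence between permutations and elementary subdigraphs\<close>

lemma elementary_subdigraph_permutation_digraph:
  assumes "pair_digraph D" "p permutes pverts D" "parcs (permutation_digraph p) \<subseteq> parcs D"
  shows "elementary_subdigraph (permutation_digraph p) D"
proof -
  interpret pair_digraph D by fact
  let ?E = "permutation_digraph p"
  have wf: "wf_digraph (with_proj ?E)"
    using permutes_inj[OF assms(2)]
    by unfold_locales (auto simp: permutation_digraph_def inj_eq)
  have "subgraph (with_proj ?E) (with_proj D)"
    using wf assms wf_digraph
    by (auto simp: subgraph_def compatible_def permutation_digraph_def permutes_def wf_digraph_axioms)
  moreover have "out_arcs (with_proj ?E) v = {(v, p v)}" if "v \<in> pverts ?E" for v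
    using that by (auto simp: out_arcs_def permutation_digraph_def)
  moreover have "in_arcs (with_proj ?E) v = {(inv_into UNIV p v, v)}" if "v \<in> pverts ?E" for v
    using that permutes_inverses[OF assms(2)]
    by (auto simp: in_arcs_def permutation_digraph_def) metis+
  ultimately show ?thesis
    by (auto simp: elementary_subdigraph_def out_degree_def in_degree_def)
qed

text \<open>Let \<open>p\<close> follow the unique outgoing arc on \<open>pverts E\<close> and fix
  everything else. In-degree 1 makes it injective, finiteness makes it bijective, and since
  \<open>D\<close> has no loops it moves exactly the vertices of \<open>E\<close>.\<close>

lemma elementary_subdigraph_obtain_permutation:
  assumes "pair_digraph D" "elementary_subdigraph E D"
  obtains p where "p permutes pverts D" "permutation_digraph p = E"
proof -
  interpret pair_digraph D by fact
  have verts: "pverts E \<subseteq> pverts D" and arcs: "parcs E \<subseteq> parcs D"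
    and wf: "wf_digraph (with_proj E)"
    using assms(2) by (auto simp: elementary_subdigraph_def subgraph_def)
  have fin: "finite (pverts E)" using verts pair_finite_verts by (rule finite_subset)
  have ends: "x \<in> pverts E" "y \<in> pverts E" "x \<noteq> y" if "(x, y) \<in> parcs E" for x y
    using that wf_digraph.tail_in_verts[OF wf, of "(x, y)"] wf_digraph.head_in_verts[OF wf, of "(x, y)"]
      pair_no_loops[of "(x, y)"] arcs by auto
  have out: "\<exists>!w. (v, w) \<in> parcs E" if "v \<in> pverts E" for v
  proof -
    have "card (out_arcs (with_proj E) v) = 1"
      using assms(2) that by (simp add: elementary_subdigraph_def out_degree_def)
    then obtain e where "out_arcs (with_proj E) v = {e}" by (rule card_1_singletonE)
    then have "e' \<in> parcs E \<and> fst e' = v \<longleftrightarrow> e' = e" for e'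
      by (metis in_out_arcs_conv singleton_iff with_proj_simps(2,4))
    then show ?thesis by (metis fst_conv prod.collapse snd_conv)
  qed
  have in_unique: "x = y" if "v \<in> pverts E" "(x, v) \<in> parcs E" "(y, v) \<in> parcs E" for v x y
  proof -
    have "card (in_arcs (with_proj E) v) = 1"
      using assms(2) that by (simp add: elementary_subdigraph_def in_degree_def)
    then obtain e where "in_arcs (with_proj E) v = {e}" by (rule card_1_singletonE)
    then have "e' \<in> parcs E \<and> snd e' = v \<longleftrightarrow> e' = e" for e'
      by (metis in_in_arcs_conv singleton_iff with_proj_simps(2,5))
    then show ?thesis using that by (metis fst_conv snd_conv)
  qed
  define p where "p v = (if v \<in> pverts E then THE w. (v, w) \<in> parcs E else v)" for v
  have p_arc: "(v, p v) \<in> parcs E" if "v \<in> pverts E" for v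
    using theI'[OF out[OF that]] that by (simp add: p_def)
  have p_eq: "p v = w" if "(v, w) \<in> parcs E" for v w
    using out p_arc ends that by metis
  have "p ` pverts E \<subseteq> pverts E" using p_arc ends by blast
  moreover have "inj_on p (pverts E)"
    using p_arc in_unique ends by (intro inj_onI) metis
  ultimately have "bij_betw p (pverts E) (pverts E)"
    using fin by (simp add: bij_betw_def endo_inj_surj)
  then have "p permutes pverts E" by (rule bij_imp_permutes) (simp add: p_def)
  then have "p permutes pverts D" using verts by (rule permutes_subset)
  moreover have moved: "p x \<noteq> x \<longleftrightarrow> x \<in> pverts E" for x
    using p_arc ends by (metis p_def)
  moreover have "permutation_digraph p = E"
  proof (rule pair_pre_digraph.equality)
    have "e \<in> parcs E \<longleftrightarrow> (\<exists>x. e = (x, p x) \<and> p x \<noteq> x)" for e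
      using p_arc p_eq ends(1) moved by (metis prod.collapse)
    then show "parcs (permutation_digraph p) = parcs E"
      by (auto simp: permutation_digraph_def)
  qed (simp_all add: permutation_digraph_def moved)
  ultimately show thesis using that by blast
qed

text \<open>The arcs record the value at each moved point, and a point without an outgoing arc is
  fixed.\<close>

lemma inj_permutation_digraph: "inj permutation_digraph"
proof (rule injI, rule ext)
  fix p q :: "'a \<Rightarrow> 'a" and x
  assume "permutation_digraph p = permutation_digraph q"
  then have "(x, y) \<in> parcs (permutation_digraph p) \<longleftrightarrow> (x, y) \<in> parcs (permutation_digraph q)" for y
    by simp
  then have "y = p x \<and> p x \<noteq> x \<longleftrightarrow> y = q x \<and> q x \<noteq> x" for y
    by (auto simp: permutation_digraph_def)
  then show "p x = q x" by metis
qed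

lemma bij_betw_permutation_digraph:
  assumes "pair_digraph D"
  shows "bij_betw permutation_digraph
    {p. p permutes pverts D \<and> parcs (permutation_digraph p) \<subseteq> parcs D \<and> card {x. p x \<noteq> x} = k}
    (elementary_subdigraphs D k)"
proof (rule bij_betw_imageI)
  show "inj_on permutation_digraph
    {p. p permutes pverts D \<and> parcs (permutation_digraph p) \<subseteq> parcs D \<and> card {x. p x \<noteq> x} = k}"
    using inj_permutation_digraph by (rule inj_on_subset) simp
  have "E \<in> permutation_digraph `
      {p. p permutes pverts D \<and> parcs (permutation_digraph p) \<subseteq> parcs D \<and> card {x. p x \<noteq> x} = k}"
    if E: "E \<in> elementary_subdigraphs D k" for E
  proof -
    obtain p where p: "p permutes pverts D" "permutation_digraph p = E"
      using elementary_subdigraph_obtain_permutation[OF assms] E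
      by (auto simp: elementary_subdigraphs_def)
    moreover have "parcs E \<subseteq> parcs D"
      using E by (auto simp: elementary_subdigraphs_def elementary_subdigraph_def subgraph_def)
    moreover have "card {x. p x \<noteq> x} = k"
      using E p(2) by (auto simp: elementary_subdigraphs_def permutation_digraph_def)
    ultimately show ?thesis by auto
  qed
  moreover have "permutation_digraph p \<in> elementary_subdigraphs D k"
    if "p permutes pverts D" "parcs (permutation_digraph p) \<subseteq> parcs D" "card {x. p x \<noteq> x} = k" for p
    using elementary_subdigraph_permutation_digraph[OF assms that(1,2)] that(3)
    by (simp add: elementary_subdigraphs_def permutation_digraph_def)
  ultimately show "permutation_digraph `
      {p. p permutes pverts D \<and> parcs (permutation_digraph p) \<subseteq> parcs D \<and> card {x. p x \<noteq> x} = k} =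
      elementary_subdigraphs D k" by blast
qed

section \<open>Coefficients as sums over permutations\<close>

lemma gain_coeff_conv_permutations:
  assumes "pair_digraph D"
  shows "gain_coeff D \<phi> k =
    (\<Sum>p | p permutes pverts D \<and> parcs (permutation_digraph p) \<subseteq> parcs D \<and> card {x. p x \<noteq> x} = k.
      of_int (sign p) * (\<Prod>x | p x \<noteq> x. - \<phi> (x, p x)))"
    (is "_ = sum ?t ?P")
proof -
  have fin: "finite (pverts D)" using assms by (simp add: pair_digraph_def pair_fin_digraph_def pair_fin_digraph_axioms_def)
  have "gain_coeff D \<phi> k =
    (\<Sum>E\<in>elementary_subdigraphs D k. (- 1) ^ num_cycles E * elementary_gain \<phi> E)" if "k \<noteq> 0"
    using that by (simp add: gain_coeff_def)
  moreover have "\<dots> = sum ?t ?P"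
    by (subst sum.reindex_bij_betw[OF bij_betw_permutation_digraph[OF assms], symmetric],
        intro sum.cong refl elementary_term_permutation_digraph)
       (use fin in \<open>auto simp: permutation_permutes\<close>)
  \<comment> \<open>\<open>gain_coeff\<close> is 1 at \<open>k = 0\<close> by its own clause. The
    sum agrees, as \<open>id\<close> contributes sign 1 and an empty product.\<close>
  moreover have "?P = {id}" if "k = 0"
  proof -
    have "p = id" if "p permutes pverts D" "card {x. p x \<noteq> x} = 0" for p
    proof -
      \<comment> \<open>\<open>card\<close> is 0 on infinite sets as well, so emptiness of the
        support needs its finiteness.\<close>
      have "finite {x. p x \<noteq> x}"
        by (rule finite_subset[OF _ fin]) (use that in \<open>auto simp: permutes_def\<close>)
      then show ?thesis using that by auto
    qed
    then show ?thesis using that by (auto simp: permutes_id permutation_digraph_def)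
  qed
  ultimately show ?thesis by (cases "k = 0") (auto simp: gain_coeff_def)
qed

section \<open>Leibniz expansion over the vertices\<close>

text \<open>Conjugation by the numbering turns permutations of indices into permutations of vertices
  and preserves the sign, so the order of \<open>vs\<close> disappears from the Leibniz
  formula.\<close>

lemma char_poly_mat_relabelled:
  fixes a :: "'a \<times> 'a \<Rightarrow> 'b :: comm_ring_1"
  assumes "distinct vs"
  shows "char_poly (mat (length vs) (length vs) (\<lambda>(i, j). a (vs ! i, vs ! j))) =
    (\<Sum>p | p permutes set vs. of_int (sign p) *
      (\<Prod>x\<in>set vs. (if p x = x then [:0, 1:] else 0) - [:a (x, p x):]))"
proof -
  let ?n = "length vs" let ?A = "mat ?n ?n (\<lambda>(i, j). a (vs ! i, vs ! j))"
  let ?I = "{0..<length vs}"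
  have bij: "bij_betw ((!) vs) ?I (set vs)"
    by (rule bij_betw_nth) (use assms in auto)
  have inj: "inj_on ((!) vs) ?I" using bij by (rule bij_betw_imp_inj_on)
  have img: "(!) vs ` ?I = set vs" using bij by (rule bij_betw_imp_surj_on)
  \<comment> \<open>The conjugation is put in the form \<open>map_permutation\<close>, for which the
    invariance of parity is available.\<close>
  have bij_perm: "bij_betw (map_permutation ?I ((!) vs)) {p. p permutes ?I} {p. p permutes set vs}"
    using bij_betw_permutations[OF bij]
    by (rule iffD1[OF bij_betw_cong, rotated])
       (auto simp: map_permutation_def restrict_id_def img fun_eq_iff)
  have "char_poly ?A = (\<Sum>p | p permutes ?I. of_int (sign p) *
      (\<Prod>i = 0..<?n. char_poly_matrix ?A $$ (i, p i)))"
    unfolding char_poly_def by (rule det_def'[OF char_poly_matrix_closed]) simp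
  also have "\<dots> = (\<Sum>p | p permutes ?I. of_int (sign (map_permutation ?I ((!) vs) p)) *
      (\<Prod>x\<in>set vs. (if map_permutation ?I ((!) vs) p x = x then [:0, 1:] else 0) -
        [:a (x, map_permutation ?I ((!) vs) p x):]))"
  proof (intro sum.cong refl arg_cong2[where f = "(*)"])
    fix p assume p: "p \<in> {p. p permutes ?I}"
    let ?q = "map_permutation ?I ((!) vs) p"
    have [simp]: "p i < ?n" if "i < ?n" for i
      using p that permutes_in_image[of p ?I i] by auto
    show "of_int (sign p) = (of_int (sign ?q) :: 'b poly)"
      using evenperm_map_permutation[OF inj, of p] p by (simp add: sign_def)
    have "(\<Prod>i = 0..<?n. char_poly_matrix ?A $$ (i, p i)) =
        (\<Prod>i\<in>?I. (if ?q (vs ! i) = vs ! i then [:0, 1:] else 0) - [:a (vs ! i, ?q (vs ! i)):])"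
    proof (rule prod.cong)
      fix i assume i: "i \<in> ?I"
      have "?q (vs ! i) = vs ! p i" using map_permutation_apply[OF inj i] by simp
      moreover have "vs ! p i = vs ! i \<longleftrightarrow> i = p i"
        using i assms by (auto simp: nth_eq_iff_index_eq)
      ultimately show "char_poly_matrix ?A $$ (i, p i) =
          (if ?q (vs ! i) = vs ! i then [:0, 1:] else 0) - [:a (vs ! i, ?q (vs ! i)):]"
        using i by (simp add: char_poly_matrix_def)
    qed simp
    also have "\<dots> = (\<Prod>x\<in>set vs. (if ?q x = x then [:0, 1:] else 0) - [:a (x, ?q x):])"
      by (rule prod.reindex_bij_betw[OF bij])
    finally show "(\<Prod>i = 0..<?n. char_poly_matrix ?A $$ (i, p i)) = \<dots>" .
  qed
  also have "\<dots> = (\<Sum>p | p permutes set vs. of_int (sign p) *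
      (\<Prod>x\<in>set vs. (if p x = x then [:0, 1:] else 0) - [:a (x, p x):]))"
    by (rule sum.reindex_bij_betw[OF bij_perm])
  finally show ?thesis .
qed

lemma leibniz_product_eq_monom:
  assumes "pair_digraph D" "p permutes pverts D"
  shows "(\<Prod>x\<in>pverts D. (if p x = x then [:0, 1:] else 0) -
      [:if (x, p x) \<in> parcs D then \<phi> (x, p x) else 0:]) =
    (if parcs (permutation_digraph p) \<subseteq> parcs D
     then monom (\<Prod>x | p x \<noteq> x. - \<phi> (x, p x)) (card (pverts D) - card {x. p x \<noteq> x}) else (0 :: complex poly))"
    (is "prod ?t _ = _")
proof -
  interpret pair_digraph D by fact
  let ?S = "{x. p x \<noteq> x}" let ?V = "pverts D"
  note fin = pair_finite_verts
  have S: "?S \<subseteq> ?V" using assms(2) by (auto simp: permutes_def)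
  show ?thesis
  proof (cases "parcs (permutation_digraph p) \<subseteq> parcs D")
    case True
    have "prod ?t ?V = prod ?t (?V - ?S) * prod ?t ?S"
      by (rule prod.subset_diff[OF S fin])
    \<comment> \<open>At a fixed point the gain entry is 0, as \<open>D\<close> has no loops, and
      only the variable remains.\<close>
    also have "prod ?t (?V - ?S) = (\<Prod>x\<in>?V - ?S. monom 1 1)"
      by (rule prod.cong) (auto dest: pair_no_loops simp: monom_altdef)
    also have "\<dots> = monom 1 (card ?V - card ?S)"
      using fin S by (simp add: monom_power card_Diff_subset finite_subset[OF S fin])
    also have "prod ?t ?S = (\<Prod>x\<in>?S. [:- \<phi> (x, p x):])"
      using True by (intro prod.cong) (auto simp: permutation_digraph_def)
    also have "\<dots> = [:\<Prod>x\<in>?S. - \<phi> (x, p x):]"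
      by (induction rule: infinite_finite_induct[of _ ?S]) (auto simp: one_pCons)
    finally show ?thesis using True by (simp add: smult_monom)
  next
    case False
    then obtain x where x: "p x \<noteq> x" "(x, p x) \<notin> parcs D"
      by (auto simp: permutation_digraph_def)
    then have "prod ?t ?V = 0" using S fin by (intro prod_zero bexI[of _ x]) auto
    then show ?thesis using False by simp
  qed
qed

theorem corollary2p5:
  fixes D :: "'a pair_pre_digraph"
    and \<phi> :: "'a \<times> 'a \<Rightarrow> complex"
    and vs :: "'a list"
    and n :: nat
  assumes "T_gain_digraph D \<phi>"
    and "distinct vs" and "set vs = pverts D" and "length vs = n"
  shows "char_poly (gain_adjacency_matrix D \<phi> vs) =
           (\<Sum>k = 0..n. monom (gain_coeff D \<phi> k) (n - k))"
proof -
  have D: "pair_digraph D" using assms(1) by (simp add: T_gain_digraph_def)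
  have fin: "finite (pverts D)" using assms(3) by (metis finite_set)
  have n: "card (pverts D) = n" using assms by (metis distinct_card)
  let ?P = "{p. p permutes pverts D \<and> parcs (permutation_digraph p) \<subseteq> parcs D}"
  let ?g = "\<lambda>p. of_int (sign p) * (\<Prod>x | p x \<noteq> x. - \<phi> (x, p x))"
  have finP: "finite {p. p permutes pverts D}" using fin by (rule finite_permutations)
  have "char_poly (gain_adjacency_matrix D \<phi> vs) =
    (\<Sum>p | p permutes pverts D. of_int (sign p) *
      (\<Prod>x\<in>pverts D. (if p x = x then [:0, 1:] else 0) -
        [:if (x, p x) \<in> parcs D then \<phi> (x, p x) else 0:]))"
    using char_poly_mat_relabelled[OF assms(2), of "\<lambda>e. if e \<in> parcs D then \<phi> e else 0"]
    by (simp add: gain_adjacency_matrix_def assms(3))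
  \<comment> \<open>Permutations that leave the arcs of \<open>D\<close> contribute 0 and drop out.
    For the others the sign, being 1 or -1, moves into the monomial.\<close>
  also have "\<dots> = (\<Sum>p\<in>?P. monom (?g p) (n - card {x. p x \<noteq> x}))"
    by (intro sum.mono_neutral_cong_right finP)
       (auto simp: leibniz_product_eq_monom[OF D] n sign_def minus_monom)
  \<comment> \<open>Grouping by the number of moved points collects equal exponents; additivity of
    \<open>monom\<close> in the coefficient then yields \<open>gain_coeff\<close>.\<close>
  also have "\<dots> = (\<Sum>k = 0..n. \<Sum>p\<in>{p \<in> ?P. card {x. p x \<noteq> x} = k}. monom (?g p) (n - card {x. p x \<noteq> x}))"
  proof (rule sum.group[symmetric])
    show "finite ?P" by (rule finite_subset[OF _ finP]) auto
    have "card {x. p x \<noteq> x} \<le> n" if "p permutes pverts D" for p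
      unfolding n[symmetric] by (rule card_mono[OF fin]) (use that in \<open>auto simp: permutes_def\<close>)
    then show "(\<lambda>p. card {x. p x \<noteq> x}) ` ?P \<subseteq> {0..n}" by auto
  qed simp
  also have "\<dots> = (\<Sum>k = 0..n. monom (gain_coeff D \<phi> k) (n - k))"
    by (intro sum.cong refl)
       (simp add: gain_coeff_conv_permutations[OF D] monom_hom.hom_sum conj_assoc)
  finally show ?thesis .
qed

end
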